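(* Let $\alpha\in\mathbb{R}$ and let $\hat\gamma:2\pi\mathbb{T}\to(0,\infty)$ be a surface energy density. Consider the scheme (SP-PFEM) described in the context, with area $A^m$ and energy $W^m$ of the polygonal curve $\Gamma^m$. (1) (Area decay rate.) For any stabilizing function $k$, every solution of (SP-PFEM) satisfies $$\frac{A^{m+1}-A^m}{\tau}=-\bigl(\mu^{m+1},1\bigr)^h_{\Gamma^m},\qquad \forall\, 0\le m\le M-1 .$$ (2) (Energy stability, $\alpha=-1$.) If $\alpha=-1$ and $\hat\gamma\in C^2(2\pi\mathbb{T})$ satisfies $3\hat\gamma(\theta)-\hat\gamma(\theta-\pi)\ge 0$ for all $\theta\in 2\pi\mathbb{T}$, then (SP-PFEM) is unconditionally energy stable for sufficiently large $k$: there is a function $k_*:2\pi\mathbb{T}\to\mathbb{R}$, depending only on $\hat\gamma$ and $\alpha$, such that whenever $k(\theta)\ge k_*(\theta)$ for all $\theta$, every solution of (SP-PFEM) (for any mesh size, any time step and any initial polygonal curve) satisfies $$W^{m+1}\le W^m\le\cdots\le W^0,\qquad\forall\,0\le m\le M-1 .$$ (3) (Energy stability, $\alpha\ne-1$.) If $\alpha\neq -1$ and $\hat\gamma\in C^2(2\pi\mathbb{T})$ satisfies the strict condition $3\hat\gamma(\theta)-\hat\gamma(\theta-\pi)>0$ for all $\theta\in 2\pi\mathbb{T}$, then the same conclusion as in (2) holds, that is, there is a function $k_*:2\pi\mathbb{T}\to\mathbb{R}$ depending only on $\hat\gamma$ and $\alpha$ such that $W^{m+1}\le W^m\le\cdots\le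 W^0$ for all $0\le m\le M-1$ for every solution of (SP-PFEM) with $k\ge k_*$ pointwise.
   Context: Notation: $2\pi\mathbb{T}=\mathbb{R}/2\pi\mathbb{Z}$. For $\theta\in2\pi\mathbb{T}$ let $\boldsymbol{n}(\theta)=(-\sin\theta,\cos\theta)^T$, $\boldsymbol{\tau}(\theta)=(\cos\theta,\sin\theta)^T$, and $\boldsymbol{\xi}(\theta)=\hat\gamma(\theta)\boldsymbol{n}(\theta)-\hat\gamma'(\theta)\boldsymbol{\tau}(\theta)$. For $\alpha\in\mathbb{R}$ and a stabilizing function $k:2\pi\mathbb{T}\to\mathbb{R}$, the $\alpha$-surface energy matrix is $$\hat{\boldsymbol{G}}_k^\alpha(\theta)=\hat\gamma(\theta)I_2-\boldsymbol{n}(\theta)\boldsymbol{\xi}(\theta)^T+\alpha\,\boldsymbol{\xi}(\theta)\boldsymbol{n}(\theta)^T+k(\theta)\boldsymbol{n}(\theta)\boldsymbol{n}(\theta)^T .$$ For $\boldsymbol{v}=(v_1,v_2)^T$, $\boldsymbol{v}^\perp=(v_2,-v_1)^T$ (clockwise rotation by $\pi/2$), so that $\boldsymbol{n}(\theta)=-\boldsymbol{\tau}(\theta)^\perp$. Discretization: $N>2$ is an integer, $h=1/N$, $\rho_j=jh$, $I_j=[\rho_{j-1},\rho_j]$, $\mathbb{I}=[0,1]$; $\mathbb{K}_p^h$ is the space of continuous functions $u$ on $\mathbb{I}$ that are affine on each $I_j$ and satisfy $u(0)=u(1)$. $T>0$, $M\geq 1$ an integer, $\tau=T/M$, $t_m=m\tau$.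 The closed polygonal curve $\Gamma^m$ is given by $\boldsymbol{X}^m=(x^m,y^m)^T\in[\mathbb{K}_p^h]^2$, with $\boldsymbol{h}_j^m=\boldsymbol{X}^m(\rho_j)-\boldsymbol{X}^m(\rho_{j-1})$; throughout it is assumed that $\min_{1\le j\le N}|\boldsymbol{h}_j^m|>0$ for all $m=0,\dots,M$. On $I_j$, $\theta^m|_{I_j}=\theta_j^m$ is defined by $(\cos\theta_j^m,\sin\theta_j^m)^T=\boldsymbol{h}_j^m/|\boldsymbol{h}_j^m|$. For (scalar or vector valued, in the latter case with dot product) functions with one-sided limits at the nodes, $$(u,v)^h_{\Gamma^m}=\sum_{j=1}^N\frac{|\boldsymbol{h}_j^m|}{2}\bigl(u(\rho_j^-)v(\rho_j^-)+u(\rho_{j-1}^+)v(\rho_{j-1}^+)\bigr),$$ and $\partial_{s^m}f|_{I_j}=\dfrac{f(\rho_j)-f(\rho_{j-1})}{|\boldsymbol{h}_j^m|}$. Set $\boldsymbol{n}^{m+\frac12}=-\frac12(\partial_{s^m}\boldsymbol{X}^m+\partial_{s^m}\boldsymbol{X}^{m+1})^\perp$. (SP-PFEM): given $\boldsymbol{X}^0\in[\mathbb{K}_p^h]^2$, for $m=0,\dots,M-1$ find $(\boldsymbol{X}^{m+1},\mu^{m+1})\in[\mathbb{K}_p^h]^2\times\mathbb{K}_p^h$ such that $$\Bigl(\boldsymbol{n}^{m+\frac12}\cdot\tfrac{\boldsymbol{X}^{m+1}-\boldsymbol{X}^m}{\tau},\varphi^h\Bigr)^h_{\Gamma^m}+\bigl(\mu^{m+1},\varphi^h\bigr)^h_{\Gamma^m}=0\quad\forall\varphi^h\in\mathbb{K}_p^h,$$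 $$\bigl(\mu^{m+1}\boldsymbol{n}^{m+\frac12},\boldsymbol{\omega}^h\bigr)^h_{\Gamma^m}-\bigl(\hat{\boldsymbol{G}}_k^\alpha(\theta^m)\partial_{s^m}\boldsymbol{X}^{m+1},\partial_{s^m}\boldsymbol{\omega}^h\bigr)^h_{\Gamma^m}=0\quad\forall\boldsymbol{\omega}^h\in[\mathbb{K}_p^h]^2 .$$ The area and energy are $$A^m=\frac12\sum_{j=1}^N\bigl(x^m(\rho_j)-x^m(\rho_{j-1})\bigr)\bigl(y^m(\rho_j)+y^m(\rho_{j-1})\bigr),\qquad W^m=\sum_{j=1}^N\hat\gamma(\theta_j^m)|\boldsymbol{h}_j^m| .$$ In (1), $\hat\gamma$ is assumed differentiable so that the scheme is defined. *)

theory Defs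
  imports "HOL-Analysis.Analysis" "HOL-Library.Periodic_Fun"
begin

text \<open>
  Functions on the circle of length \<open>2 * pi\<close> are functions on the real line with
  \<^term>\<open>periodic_fun_simple f (2 * pi)\<close>.
\<close>

definition C2_fun :: "(real \<Rightarrow> real) \<Rightarrow> bool" where
  "C2_fun f \<longleftrightarrow> (\<forall>\<theta>. f differentiable (at \<theta>)) \<and> (\<forall>\<theta>. deriv f differentiable (at \<theta>)) \<and>
     continuous_on UNIV (deriv (deriv f))"

definition nvec :: "real \<Rightarrow> real^2" where
  "nvec \<theta> = vector [- sin \<theta>, cos \<theta>]"

definition tvec :: "real \<Rightarrow> real^2" where
  "tvec \<theta> = vector [cos \<theta>, sin \<theta>]"

definition xivec :: "(real \<Rightarrow> real) \<Rightarrow> real \<Rightarrow> real^2" where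
  "xivec \<gamma> \<theta> = \<gamma> \<theta> *\<^sub>R nvec \<theta> - deriv \<gamma> \<theta> *\<^sub>R tvec \<theta>"

definition perp :: "real^2 \<Rightarrow> real^2" where
  "perp v = vector [v $ 2, - (v $ 1)]"

definition outer :: "real^2 \<Rightarrow> real^2 \<Rightarrow> real^2^2" where
  "outer u v = (\<chi> i j. u $ i * v $ j)"

definition Gmat :: "(real \<Rightarrow> real) \<Rightarrow> real \<Rightarrow> (real \<Rightarrow> real) \<Rightarrow> real \<Rightarrow> real^2^2" where
  "Gmat \<gamma> \<alpha> k \<theta> = \<gamma> \<theta> *\<^sub>R mat 1 - outer (nvec \<theta>) (xivec \<gamma> \<theta>)
     + \<alpha> *\<^sub>R outer (xivec \<gamma> \<theta>) (nvec \<theta>) + k \<theta> *\<^sub>R outer (nvec \<theta>) (nvec \<theta>)"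

definition node :: "nat \<Rightarrow> nat \<Rightarrow> real" where
  "node N j = real j * (1 / real N)"

text \<open>
  Mesh functions are functions on the real line of which only the values on \<open>[0,1]\<close> matter.
\<close>

definition Kph :: "nat \<Rightarrow> (real \<Rightarrow> real) set" where
  "Kph N = {u. continuous_on {0..1} u \<and>
     (\<forall>j\<in>{1..N}. \<exists>a b. \<forall>\<rho>\<in>{node N (j - 1)..node N j}. u \<rho> = a * \<rho> + b) \<and> u 0 = u 1}"

definition Kph2 :: "nat \<Rightarrow> (real \<Rightarrow> real^2) set" where
  "Kph2 N = {X. \<forall>i. (\<lambda>\<rho>. X \<rho> $ i) \<in> Kph N}"

definition edge :: "nat \<Rightarrow> (real \<Rightarrow> real^2) \<Rightarrow> nat \<Rightarrow> real^2" where
  "edge N X j = X (node N j) - X (node N (j - 1))"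

text \<open>
  \<open>cell N \<rho>\<close> is the index \<open>j\<close> with \<open>node N (j - 1) < \<rho> \<le> node N j\<close>. The functions defined from
  it below are constant on the interior of each mesh interval; their values at the nodes are
  immaterial, since \<open>lumped\<close> only sees one-sided limits.
\<close>

definition cell :: "nat \<Rightarrow> real \<Rightarrow> nat" where
  "cell N \<rho> = nat \<lceil>\<rho> * real N\<rceil>"

text \<open>
  The angle of \<open>v \<noteq> 0\<close> is determined modulo \<open>2 * pi\<close> only; an arbitrary representative is chosen,
  and it enters the scheme and the energy only through \<open>2 * pi\<close>-periodic functions.
\<close>

definition angle_of :: "real^2 \<Rightarrow> real" where
  "angle_of v = (SOME \<theta>. tvec \<theta> = v /\<^sub>R norm v)"

definition theta :: "nat \<Rightarrow> (real \<Rightarrow> real^2) \<Rightarrow> real \<Rightarrow> real" where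
  "theta N X \<rho> = angle_of (edge N X (cell N \<rho>))"

definition ds :: "nat \<Rightarrow> (real \<Rightarrow> real^2) \<Rightarrow> (real \<Rightarrow> real^2) \<Rightarrow> real \<Rightarrow> real^2" where
  "ds N X f \<rho> = (let j = cell N \<rho> in
     (f (node N j) - f (node N (j - 1))) /\<^sub>R norm (edge N X j))"

text \<open>For real-valued functions the inner product below is multiplication.\<close>

definition lumped ::
  "nat \<Rightarrow> (real \<Rightarrow> real^2) \<Rightarrow> (real \<Rightarrow> 'a::real_inner) \<Rightarrow> (real \<Rightarrow> 'a) \<Rightarrow> real" where
  "lumped N X u v = (\<Sum>j=1..N. norm (edge N X j) / 2 *
     (Lim (at_left (node N j)) u \<bullet> Lim (at_left (node N j)) v
      + Lim (at_right (node N (j - 1))) u \<bullet> Lim (at_right (node N (j - 1))) v))"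

definition nhalf :: "nat \<Rightarrow> (real \<Rightarrow> real^2) \<Rightarrow> (real \<Rightarrow> real^2) \<Rightarrow> real \<Rightarrow> real^2" where
  "nhalf N X Y \<rho> = - (1/2) *\<^sub>R perp (ds N X X \<rho> + ds N X Y \<rho>)"

text \<open>One time step from the curve \<open>X\<close> to the curve \<open>Y\<close> with time step size \<open>dt\<close>.\<close>

definition SP_PFEM_step ::
  "(real \<Rightarrow> real) \<Rightarrow> real \<Rightarrow> (real \<Rightarrow> real) \<Rightarrow> nat \<Rightarrow> real \<Rightarrow>
   (real \<Rightarrow> real^2) \<Rightarrow> (real \<Rightarrow> real^2) \<Rightarrow> (real \<Rightarrow> real) \<Rightarrow> bool" where
  "SP_PFEM_step \<gamma> \<alpha> k N dt X Y \<mu> \<longleftrightarrow>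
     Y \<in> Kph2 N \<and> \<mu> \<in> Kph N \<and>
     (\<forall>\<phi>\<in>Kph N.
        lumped N X (\<lambda>\<rho>. nhalf N X Y \<rho> \<bullet> ((Y \<rho> - X \<rho>) /\<^sub>R dt)) \<phi> + lumped N X \<mu> \<phi> = 0) \<and>
     (\<forall>\<omega>\<in>Kph2 N.
        lumped N X (\<lambda>\<rho>. \<mu> \<rho> *\<^sub>R nhalf N X Y \<rho>) \<omega>
        - lumped N X (\<lambda>\<rho>. Gmat \<gamma> \<alpha> k (theta N X \<rho>) *v ds N X Y \<rho>) (ds N X \<omega>) = 0)"

text \<open>
  Solutions on the time interval \<open>[0,T]\<close> with \<open>M\<close> time steps, including the standing assumptions
  on \<open>N\<close>, \<open>T\<close>, \<open>M\<close> and on the edges. The value \<open>\<mu> 0\<close> is irrelevant.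
\<close>

definition SP_PFEM_solution ::
  "(real \<Rightarrow> real) \<Rightarrow> real \<Rightarrow> (real \<Rightarrow> real) \<Rightarrow> nat \<Rightarrow> real \<Rightarrow> nat \<Rightarrow>
   (nat \<Rightarrow> real \<Rightarrow> real^2) \<Rightarrow> (nat \<Rightarrow> real \<Rightarrow> real) \<Rightarrow> bool" where
  "SP_PFEM_solution \<gamma> \<alpha> k N T M X \<mu> \<longleftrightarrow>
     N > 2 \<and> T > 0 \<and> M \<ge> 1 \<and> X 0 \<in> Kph2 N \<and>
     (\<forall>m\<le>M. (MIN j\<in>{1..N}. norm (edge N (X m) j)) > 0) \<and>
     (\<forall>m<M. SP_PFEM_step \<gamma> \<alpha> k N (T / real M) (X m) (X (m + 1)) (\<mu> (m + 1)))"

definition area :: "nat \<Rightarrow> (real \<Rightarrow> real^2) \<Rightarrow> real" where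
  "area N X = 1/2 * (\<Sum>j=1..N. (X (node N j) $ 1 - X (node N (j - 1)) $ 1) *
     (X (node N j) $ 2 + X (node N (j - 1)) $ 2))"

definition energy :: "(real \<Rightarrow> real) \<Rightarrow> nat \<Rightarrow> (real \<Rightarrow> real^2) \<Rightarrow> real" where
  "energy \<gamma> N X = (\<Sum>j=1..N. \<gamma> (angle_of (edge N X j)) * norm (edge N X j))"

text \<open>
  The chain of inequalities \<open>W (m + 1) \<le> W m \<le> \<dots> \<le> W 0\<close> for every \<open>m < M\<close>, for all meshes,
  time steps, initial curves and solutions.
\<close>

definition energy_stable :: "(real \<Rightarrow> real) \<Rightarrow> real \<Rightarrow> (real \<Rightarrow> real) \<Rightarrow> bool" where
  "energy_stable \<gamma> \<alpha> k \<longleftrightarrow>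
     (\<forall>N T M X \<mu>. SP_PFEM_solution \<gamma> \<alpha> k N T M X \<mu> \<longrightarrow>
        (\<forall>m<M. \<forall>l\<le>m. energy \<gamma> N (X (l + 1)) \<le> energy \<gamma> N (X l)))"

definition stable_for_large_k :: "(real \<Rightarrow> real) \<Rightarrow> real \<Rightarrow> bool" where
  "stable_for_large_k \<gamma> \<alpha> \<longleftrightarrow>
     (\<exists>kstar. periodic_fun_simple kstar (2 * pi) \<and>
        (\<forall>k. periodic_fun_simple k (2 * pi) \<longrightarrow> (\<forall>\<theta>. kstar \<theta> \<le> k \<theta>) \<longrightarrow> energy_stable \<gamma> \<alpha> k))"

end

theory Submission
  imports Defs
begin

text \<open>
  For a step from \<open>X\<close> to \<open>Y\<close> write \<open>h\<close> and \<open>q\<close> for an edge of \<open>X\<close> and the corresponding edge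
  of \<open>Y\<close>.

  \<^emph>\<open>Area.\<close> With the test function \<open>1\<close> the first equation of the scheme leaves the quantity
  \<open>(nhalf \<bullet> (Y - X), 1)\<close>. The average of the old and the new normal in \<open>nhalf\<close> is made so that this
  equals the change of area exactly: edge by edge the two differ by a discrete derivative, whose
  sum over a closed polygon vanishes (\<open>area_diff_eq\<close>).

  \<^emph>\<open>Energy.\<close> Testing the second equation with \<open>Y - X\<close> and the first with \<open>\<mu>\<close> makes the two mixed
  terms cancel, so that the sum over the edges of
  \<open>norm h * ((G *v (q /\<^sub>R norm h)) \<bullet> ((q - h) /\<^sub>R norm h))\<close> equals
  \<open>- dt * (\<mu>, \<mu>) \<le> 0\<close>. It suffices that each summand bounds the energy increment
  \<open>\<gamma> (angle q) * norm q - \<gamma> (angle h) * norm h\<close> of its edge. Let \<open>\<theta>\<close> be the angle of \<open>h\<close>,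
  \<open>\<theta> + \<phi>\<close> that of \<open>q\<close>, and \<open>r = norm q / norm h\<close>. After division by \<open>norm h\<close> the bound says that
  a quadratic polynomial in \<open>r\<close> with constant term \<open>\<gamma> \<theta> > 0\<close> is nonnegative, which follows once
  its discriminant is nonpositive for all \<open>\<phi>\<close>; this is \<open>stabilizes \<gamma> \<alpha> \<theta> (k \<theta>)\<close>.

  \<^emph>\<open>Choice of \<open>k\<close>.\<close> The condition has the form \<open>E \<phi> + K * (sin \<phi>)\<^sup>2 \<ge> 0\<close> with \<open>K = 4 * \<gamma> \<theta> * k \<theta>\<close>,
  so that a large \<open>k\<close> helps except where \<open>sin \<phi> = 0\<close>. At \<open>\<phi> = 0\<close> both \<open>E\<close> and its derivative
  vanish whatever \<open>\<gamma>\<close> and \<open>\<alpha>\<close> are. At \<open>\<phi> = pi\<close> one has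
  \<open>E pi = (3 * \<gamma> \<theta> - \<gamma> (\<theta> - pi)) * (\<gamma> \<theta> + \<gamma> (\<theta> - pi))\<close>, and the hypothesis on \<open>\<gamma>\<close> enters here.
  If \<open>E pi > 0\<close> nothing more is needed near \<open>pi\<close>. If \<open>E pi = 0\<close> then \<open>\<theta>\<close> minimises
  \<open>3 * \<gamma> x - \<gamma> (x - pi)\<close>, hence \<open>deriv \<gamma> (\<theta> - pi) = 3 * deriv \<gamma> \<theta>\<close>, and the derivative of \<open>E\<close> at
  \<open>pi\<close> is a multiple of \<open>(1 + \<alpha>) * deriv \<gamma> \<theta>\<close>; this is why equality is harmless for \<open>\<alpha> = -1\<close>.
  Where \<open>E\<close> has a double zero, \<open>K * (sin \<phi>)\<^sup>2\<close> with large \<open>K\<close> turns it into a strict local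
  minimum. So every angle has a neighbourhood with a suitable \<open>K\<close>, and compactness of a period
  gives one \<open>K\<close> for all \<open>\<phi>\<close> (\<open>exists_stabilizing\<close>). The constant is chosen separately for
  each \<open>\<theta>\<close>, since \<open>kstar\<close> may be any periodic function.
\<close>

section \<open>Limits at the nodes and the lumped inner product\<close>

lemma node_less: "N > 0 \<Longrightarrow> j \<ge> 1 \<Longrightarrow> node N (j - 1) < node N j"
  unfolding node_def by (simp add: divide_simps)

lemma node_in_unit: "N > 0 \<Longrightarrow> j \<le> N \<Longrightarrow> node N j \<in> {0..1}"
  unfolding node_def by (simp add: divide_simps)

lemma cell_eq:
  assumes "N > 0" "j \<ge> 1" "node N (j - 1) < \<rho>" "\<rho> < node N j"
  shows "cell N \<rho> = j"
proof -
  have "real_of_int (int j) - 1 < \<rho> * real N" "\<rho> * real N \<le> real_of_int (int j)"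
    using assms unfolding node_def by (auto simp: divide_simps of_nat_diff)
  then have "\<lceil>\<rho> * real N\<rceil> = int j"
    by (simp add: ceiling_eq_iff)
  then show ?thesis
    unfolding cell_def by simp
qed

text \<open>
  Every quantity of the scheme other than the mesh functions is a function of the cell index, so
  this single fact gives all its one-sided limits.
\<close>

lemma tendsto_cell:
  fixes F :: "nat \<Rightarrow> 'a::topological_space"
  assumes "N > 0" "j \<ge> 1"
  shows tendsto_cell_left: "((\<lambda>\<rho>. F (cell N \<rho>)) \<longlongrightarrow> F j) (at_left (node N j))"
    and tendsto_cell_right: "((\<lambda>\<rho>. F (cell N \<rho>)) \<longlongrightarrow> F j) (at_right (node N (j - 1)))"
proof -
  note less = node_less[OF assms]
  have "eventually (\<lambda>\<rho>. F (cell N \<rho>) = F j) (at_left (node N j))"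
    using less cell_eq[OF assms] by (auto simp: eventually_at_left)
  then show "((\<lambda>\<rho>. F (cell N \<rho>)) \<longlongrightarrow> F j) (at_left (node N j))"
    by (rule tendsto_eventually)
  have "eventually (\<lambda>\<rho>. F (cell N \<rho>) = F j) (at_right (node N (j - 1)))"
    using less cell_eq[OF assms] by (auto simp: eventually_at_right)
  then show "((\<lambda>\<rho>. F (cell N \<rho>)) \<longlongrightarrow> F j) (at_right (node N (j - 1)))"
    by (rule tendsto_eventually)
qed

lemma Kph_tendsto:
  assumes "N > 0" "1 \<le> j" "j \<le> N" "u \<in> Kph N"
  shows "(u \<longlongrightarrow> u (node N j)) (at_left (node N j))"
    and "(u \<longlongrightarrow> u (node N (j - 1))) (at_right (node N (j - 1)))"
proof -
  let ?a = "node N (j - 1)" and ?b = "node N j"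
  have less: "?a < ?b"
    using assms by (intro node_less)
  have "{?a..?b} \<subseteq> {0..1}"
    using node_in_unit[of N j] node_in_unit[of N "j - 1"] assms by auto
  then have "continuous_on {?a..?b} u"
    using assms(4) continuous_on_subset unfolding Kph_def by blast
  then show "(u \<longlongrightarrow> u ?b) (at_left ?b)" "(u \<longlongrightarrow> u ?a) (at_right ?a)"
    using less by (auto simp: continuous_on_Icc_at_leftD continuous_on_Icc_at_rightD)
qed

lemma Kph2_tendsto:
  assumes "N > 0" "1 \<le> j" "j \<le> N" "X \<in> Kph2 N"
  shows "(X \<longlongrightarrow> X (node N j)) (at_left (node N j))"
    and "(X \<longlongrightarrow> X (node N (j - 1))) (at_right (node N (j - 1)))"
  using assms(4) Kph_tendsto[OF assms(1-3)] unfolding Kph2_def by (auto intro!: vec_tendstoI)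

text \<open>
  From here on the scheme is a system of finite sums over edges: limits appear only in the
  premises of this lemma.
\<close>

lemma lumped_eq:
  assumes ul: "\<And>j. 1 \<le> j \<Longrightarrow> j \<le> N \<Longrightarrow> (u \<longlongrightarrow> ul j) (at_left (node N j))"
    and ur: "\<And>j. 1 \<le> j \<Longrightarrow> j \<le> N \<Longrightarrow> (u \<longlongrightarrow> ur j) (at_right (node N (j - 1)))"
    and vl: "\<And>j. 1 \<le> j \<Longrightarrow> j \<le> N \<Longrightarrow> (v \<longlongrightarrow> vl j) (at_left (node N j))"
    and vr: "\<And>j. 1 \<le> j \<Longrightarrow> j \<le> N \<Longrightarrow> (v \<longlongrightarrow> vr j) (at_right (node N (j - 1)))"
  shows "lumped N X u v
    = (\<Sum>j=1..N. norm (edge N X j) / 2 * (ul j \<bullet> vl j + ur j \<bullet> vr j))"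
  unfolding lumped_def
proof (rule sum.cong, rule refl)
  fix j assume "j \<in> {1..N}"
  then have j: "1 \<le> j" "j \<le> N" by auto
  have "Lim (at_left (node N j)) u = ul j" "Lim (at_left (node N j)) v = vl j"
    "Lim (at_right (node N (j - 1))) u = ur j" "Lim (at_right (node N (j - 1))) v = vr j"
    using ul[OF j] ur[OF j] vl[OF j] vr[OF j] by (auto intro: tendsto_Lim)
  then show "norm (edge N X j) / 2 *
     (Lim (at_left (node N j)) u \<bullet> Lim (at_left (node N j)) v
      + Lim (at_right (node N (j - 1))) u \<bullet> Lim (at_right (node N (j - 1))) v)
    = norm (edge N X j) / 2 * (ul j \<bullet> vl j + ur j \<bullet> vr j)"
    by (simp only:)
qed

lemmas lumped_real_eq = lumped_eq[where 'a = real, unfolded inner_real_def]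

lemma Kph_const: "(\<lambda>_. c) \<in> Kph N"
proof -
  have "\<exists>a b. \<forall>\<rho>\<in>S. c = a * \<rho> + b" for S :: "real set"
    by (rule exI[of _ 0], rule exI[of _ c]) simp
  then show ?thesis
    unfolding Kph_def by simp
qed

lemma Kph_diff:
  assumes "u \<in> Kph N" "v \<in> Kph N"
  shows "(\<lambda>\<rho>. u \<rho> - v \<rho>) \<in> Kph N"
proof -
  have "\<exists>a b. \<forall>\<rho>\<in>{node N (j - 1)..node N j}. u \<rho> - v \<rho> = a * \<rho> + b" if j: "j \<in> {1..N}" for j
  proof -
    obtain a b c d where
      "\<forall>\<rho>\<in>{node N (j - 1)..node N j}. u \<rho> = a * \<rho> + b"
      "\<forall>\<rho>\<in>{node N (j - 1)..node N j}. v \<rho> = c * \<rho> + d"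
      using assms j unfolding Kph_def by blast
    then have "\<forall>\<rho>\<in>{node N (j - 1)..node N j}. u \<rho> - v \<rho> = (a - c) * \<rho> + (b - d)"
      by (simp add: algebra_simps)
    then show ?thesis by blast
  qed
  then show ?thesis
    using assms unfolding Kph_def by (auto intro: continuous_on_diff)
qed

lemma Kph2_diff: "X \<in> Kph2 N \<Longrightarrow> Y \<in> Kph2 N \<Longrightarrow> (\<lambda>\<rho>. X \<rho> - Y \<rho>) \<in> Kph2 N"
  unfolding Kph2_def by (auto intro: Kph_diff)

lemma Kph2_closed: "N > 0 \<Longrightarrow> X \<in> Kph2 N \<Longrightarrow> X (node N N) = X (node N 0)"
  unfolding Kph2_def Kph_def node_def by (auto simp: vec_eq_iff)

definition nhalf_cell :: "nat \<Rightarrow> (real \<Rightarrow> real^2) \<Rightarrow> (real \<Rightarrow> real^2) \<Rightarrow> nat \<Rightarrow> real^2" where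
  "nhalf_cell N X Y j = - (1/2) *\<^sub>R perp ((edge N X j + edge N Y j) /\<^sub>R norm (edge N X j))"

lemma ds_eq_cell: "ds N X f = (\<lambda>\<rho>. (\<lambda>j. edge N f j /\<^sub>R norm (edge N X j)) (cell N \<rho>))"
  unfolding ds_def edge_def by (simp add: Let_def)

lemma nhalf_eq_cell: "nhalf N X Y = (\<lambda>\<rho>. nhalf_cell N X Y (cell N \<rho>))"
  unfolding nhalf_def nhalf_cell_def ds_eq_cell by (simp add: scaleR_add_right)

lemma lumped_mobility_eq:
  assumes N: "N > 0" and X: "X \<in> Kph2 N" and Y: "Y \<in> Kph2 N" and \<phi>: "\<phi> \<in> Kph N"
  shows "lumped N X (\<lambda>\<rho>. nhalf N X Y \<rho> \<bullet> ((Y \<rho> - X \<rho>) /\<^sub>R dt)) \<phi>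
    = (\<Sum>j=1..N. norm (edge N X j) / 2 *
        ((nhalf_cell N X Y j \<bullet> ((Y (node N j) - X (node N j)) /\<^sub>R dt)) * \<phi> (node N j)
        + (nhalf_cell N X Y j \<bullet> ((Y (node N (j - 1)) - X (node N (j - 1))) /\<^sub>R dt))
          * \<phi> (node N (j - 1))))"
  unfolding nhalf_eq_cell
  by (rule lumped_real_eq; intro tendsto_intros Kph_tendsto Kph2_tendsto tendsto_cell assms; (assumption | simp))

lemma lumped_Kph_eq:
  assumes "N > 0" "u \<in> Kph N" "v \<in> Kph N"
  shows "lumped N X u v = (\<Sum>j=1..N. norm (edge N X j) / 2 *
    (u (node N j) * v (node N j) + u (node N (j - 1)) * v (node N (j - 1))))"
  by (rule lumped_real_eq; intro Kph_tendsto assms)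

lemma lumped_force_eq:
  assumes N: "N > 0" and \<omega>: "\<omega> \<in> Kph2 N" and \<mu>: "\<mu> \<in> Kph N"
  shows "lumped N X (\<lambda>\<rho>. \<mu> \<rho> *\<^sub>R nhalf N X Y \<rho>) \<omega>
    = (\<Sum>j=1..N. norm (edge N X j) / 2 *
        ((\<mu> (node N j) *\<^sub>R nhalf_cell N X Y j) \<bullet> \<omega> (node N j)
        + (\<mu> (node N (j - 1)) *\<^sub>R nhalf_cell N X Y j) \<bullet> \<omega> (node N (j - 1))))"
  unfolding nhalf_eq_cell
  by (rule lumped_eq; intro tendsto_intros Kph_tendsto Kph2_tendsto tendsto_cell assms; (assumption | simp))

lemma lumped_stress_eq:
  assumes N: "N > 0"
  shows "lumped N X (\<lambda>\<rho>. Gmat \<gamma> \<alpha> k (theta N X \<rho>) *v ds N X Y \<rho>) (ds N X \<omega>)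
    = (\<Sum>j=1..N. norm (edge N X j) *
        ((Gmat \<gamma> \<alpha> k (angle_of (edge N X j)) *v (edge N Y j /\<^sub>R norm (edge N X j)))
          \<bullet> (edge N \<omega> j /\<^sub>R norm (edge N X j))))"
proof -
  let ?F = "\<lambda>j. Gmat \<gamma> \<alpha> k (angle_of (edge N X j)) *v (edge N Y j /\<^sub>R norm (edge N X j))"
  let ?H = "\<lambda>j. edge N \<omega> j /\<^sub>R norm (edge N X j)"
  have "lumped N X (\<lambda>\<rho>. ?F (cell N \<rho>)) (\<lambda>\<rho>. ?H (cell N \<rho>))
    = (\<Sum>j=1..N. norm (edge N X j) / 2 * (?F j \<bullet> ?H j + ?F j \<bullet> ?H j))"
    by (rule lumped_eq; rule tendsto_cell_left[where F = ?F] tendsto_cell_right[where F = ?F]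
        tendsto_cell_left[where F = ?H] tendsto_cell_right[where F = ?H]; use N in simp)
  then show ?thesis
    unfolding ds_eq_cell theta_def by (simp add: field_simps)
qed

section \<open>Change of area\<close>

lemma sum_diff_telescope:
  fixes f :: "nat \<Rightarrow> 'a::ab_group_add"
  shows "(\<Sum>j=1..N. f j - f (j - 1)) = f N - f 0"
  by (induction N) auto

text \<open>
  Write \<open>(x, y)\<close> and \<open>(x', y')\<close> for the old and new vertices. On one edge the right-hand side
  differs from the change of the trapezoidal area by the increment of
  \<open>(x * y' - x' * y + x * y - x' * y') / 2\<close> along the edge, and these increments sum to zero around
  the polygon. The factor \<open>norm (edge N X j)\<close> cancels the normalisation in \<open>nhalf\<close>, which needs
  the old edges to be nonzero.
\<close>

lemma area_diff_eq:
  assumes N: "N > 0" and X: "X \<in> Kph2 N" and Y: "Y \<in> Kph2 N"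
    and edges: "\<And>j. 1 \<le> j \<Longrightarrow> j \<le> N \<Longrightarrow> edge N X j \<noteq> 0"
  shows "area N Y - area N X = (\<Sum>j=1..N. norm (edge N X j) / 2 *
    (nhalf_cell N X Y j \<bullet> (Y (node N j) - X (node N j))
      + nhalf_cell N X Y j \<bullet> (Y (node N (j - 1)) - X (node N (j - 1)))))"
proof -
  let ?q = "\<lambda>j. (X (node N j) $ 1 * Y (node N j) $ 2 - Y (node N j) $ 1 * X (node N j) $ 2
      + X (node N j) $ 1 * X (node N j) $ 2 - Y (node N j) $ 1 * Y (node N j) $ 2) / 2"
  let ?a = "\<lambda>Z j. 1/2 * ((Z (node N j) $ 1 - Z (node N (j - 1)) $ 1) *
     (Z (node N j) $ 2 + Z (node N (j - 1)) $ 2)) :: real"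
  let ?t = "\<lambda>j. norm (edge N X j) / 2 *
    (nhalf_cell N X Y j \<bullet> (Y (node N j) - X (node N j))
      + nhalf_cell N X Y j \<bullet> (Y (node N (j - 1)) - X (node N (j - 1))))"
  have local: "?t j = ?a Y j - ?a X j + (?q j - ?q (j - 1))" if j: "j \<in> {1..N}" for j
  proof -
    have nz: "norm (edge N X j) \<noteq> 0"
      using edges j by auto
    have scaled: "norm (edge N X j) *\<^sub>R nhalf_cell N X Y j = - (1/2) *\<^sub>R perp (edge N X j + edge N Y j)"
      using nz unfolding nhalf_cell_def perp_def
      by (simp add: vec_eq_iff forall_2 field_simps)
    have half: "l / 2 * (n \<bullet> u + n \<bullet> v) = (l *\<^sub>R n) \<bullet> ((1/2) *\<^sub>R (u + v))"
      for l and n u v :: "real^2"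
      by (simp add: inner_add_right distrib_left)
    have "?t j = (- (1/2) *\<^sub>R perp (edge N X j + edge N Y j)) \<bullet>
      ((1/2) *\<^sub>R ((Y (node N j) - X (node N j)) + (Y (node N (j - 1)) - X (node N (j - 1)))))"
      by (simp only: half scaled)
    then show ?thesis
      unfolding perp_def edge_def
      by (simp add: inner_vec_def sum_2 field_simps)
  qed
  have "(\<Sum>j=1..N. ?t j) = (\<Sum>j=1..N. ?a Y j - ?a X j + (?q j - ?q (j - 1)))"
    by (rule sum.cong) (use local in auto)
  also have "\<dots> = (\<Sum>j=1..N. ?a Y j) - (\<Sum>j=1..N. ?a X j) + (\<Sum>j=1..N. ?q j - ?q (j - 1))"
    by (simp only: sum.distrib sum_subtractf)
  also have "(\<Sum>j=1..N. ?q j - ?q (j - 1)) = ?q N - ?q 0"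
    by (rule sum_diff_telescope)
  also have "\<dots> = 0"
    using Kph2_closed[OF N X] Kph2_closed[OF N Y] by simp
  finally show ?thesis
    unfolding area_def by (simp add: sum_distrib_left)
qed

lemma area_decay_step:
  assumes N: "N > 0" and dt: "dt \<noteq> 0" and X: "X \<in> Kph2 N"
    and edges: "\<And>j. 1 \<le> j \<Longrightarrow> j \<le> N \<Longrightarrow> edge N X j \<noteq> 0"
    and step: "SP_PFEM_step \<gamma> \<alpha> k N dt X Y \<mu>"
  shows "(area N Y - area N X) / dt = - lumped N X \<mu> (\<lambda>_. 1)"
proof -
  have Y: "Y \<in> Kph2 N"
    using step unfolding SP_PFEM_step_def by blast
  have "lumped N X (\<lambda>\<rho>. nhalf N X Y \<rho> \<bullet> ((Y \<rho> - X \<rho>) /\<^sub>R dt)) (\<lambda>_. 1)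
      + lumped N X \<mu> (\<lambda>_. 1) = 0"
    using step Kph_const unfolding SP_PFEM_step_def by blast
  moreover
  have area: "area N Y - area N X = (\<Sum>j=1..N. norm (edge N X j) / 2 *
    (nhalf_cell N X Y j \<bullet> (Y (node N j) - X (node N j))
      + nhalf_cell N X Y j \<bullet> (Y (node N (j - 1)) - X (node N (j - 1)))))"
    by (rule area_diff_eq[OF N X Y]) (rule edges)
  have "lumped N X (\<lambda>\<rho>. nhalf N X Y \<rho> \<bullet> ((Y \<rho> - X \<rho>) /\<^sub>R dt)) (\<lambda>_. 1)
      = (area N Y - area N X) / dt"
    unfolding lumped_mobility_eq[OF N X Y Kph_const]
    unfolding area sum_divide_distrib inner_scaleR_right
    using dt by (intro sum.cong) (simp_all add: field_simps)
  ultimately show ?thesis by simp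
qed

section \<open>The discriminant condition for one edge\<close>

text \<open>
  This is the inequality \<open>b\<^sup>2 \<le> 4 * c * a\<close> for the polynomial \<open>a * r\<^sup>2 - b * r + c\<close> in the ratio \<open>r\<close>
  of the new to the old edge length, where \<open>\<theta>\<close> is the angle of the old edge, \<open>\<phi>\<close> the angle
  through which the edge turns, \<open>c = \<gamma> \<theta>\<close>, and \<open>K\<close> stands for \<open>k \<theta>\<close>.
\<close>

definition stabilizes :: "(real \<Rightarrow> real) \<Rightarrow> real \<Rightarrow> real \<Rightarrow> real \<Rightarrow> bool" where
  "stabilizes \<gamma> \<alpha> \<theta> K \<longleftrightarrow>
    (\<forall>\<phi>. (\<gamma> \<theta> * cos \<phi> - \<alpha> * deriv \<gamma> \<theta> * sin \<phi> + \<gamma> (\<theta> + \<phi>))\<^sup>2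
      \<le> 4 * \<gamma> \<theta> * (\<gamma> \<theta> + (\<alpha> - 1) * sin \<phi> * (\<gamma> \<theta> * sin \<phi> - deriv \<gamma> \<theta> * cos \<phi>)
          + K * (sin \<phi>)\<^sup>2))"

lemma stabilizes_mono:
  assumes "stabilizes \<gamma> \<alpha> \<theta> K" "K \<le> K'" "\<gamma> \<theta> > 0"
  shows "stabilizes \<gamma> \<alpha> \<theta> K'"
  unfolding stabilizes_def
proof (intro allI, rule order_trans)
  fix \<phi>
  let ?b = "\<gamma> \<theta> + (\<alpha> - 1) * sin \<phi> * (\<gamma> \<theta> * sin \<phi> - deriv \<gamma> \<theta> * cos \<phi>)"
  show "(\<gamma> \<theta> * cos \<phi> - \<alpha> * deriv \<gamma> \<theta> * sin \<phi> + \<gamma> (\<theta> + \<phi>))\<^sup>2 \<le> 4 * \<gamma> \<theta> * (?b + K * (sin \<phi>)\<^sup>2)"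
    using assms(1) unfolding stabilizes_def by blast
  show "4 * \<gamma> \<theta> * (?b + K * (sin \<phi>)\<^sup>2) \<le> 4 * \<gamma> \<theta> * (?b + K' * (sin \<phi>)\<^sup>2)"
    using assms(2,3) by (intro mult_left_mono add_left_mono mult_right_mono) auto
qed

lemma Gmat_bilinear:
  "(Gmat \<gamma> \<alpha> k \<theta> *v u) \<bullet> w = \<gamma> \<theta> * (u \<bullet> w) - (xivec \<gamma> \<theta> \<bullet> u) * (nvec \<theta> \<bullet> w)
    + \<alpha> * (nvec \<theta> \<bullet> u) * (xivec \<gamma> \<theta> \<bullet> w) + k \<theta> * (nvec \<theta> \<bullet> u) * (nvec \<theta> \<bullet> w)"
  unfolding Gmat_def outer_def
  by (simp add: inner_vec_def sum_2 matrix_vector_mult_def mat_def algebra_simps)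

lemma tvec_inner_tvec: "tvec (\<theta> + \<phi>) \<bullet> tvec \<theta> = cos \<phi>"
proof -
  have "cos ((\<theta> + \<phi>) - \<theta>) = cos (\<theta> + \<phi>) * cos \<theta> + sin (\<theta> + \<phi>) * sin \<theta>"
    by (rule cos_diff)
  then show ?thesis
    unfolding tvec_def by (simp add: inner_vec_def sum_2)
qed

lemma nvec_inner_tvec: "nvec \<theta> \<bullet> tvec (\<theta> + \<phi>) = sin \<phi>"
proof -
  have "sin ((\<theta> + \<phi>) - \<theta>) = sin (\<theta> + \<phi>) * cos \<theta> - cos (\<theta> + \<phi>) * sin \<theta>"
    by (rule sin_diff)
  then show ?thesis
    unfolding tvec_def nvec_def by (simp add: inner_vec_def sum_2)
qed

lemma xivec_inner_tvec:
  "xivec \<gamma> \<theta> \<bullet> tvec (\<theta> + \<phi>) = \<gamma> \<theta> * sin \<phi> - deriv \<gamma> \<theta> * cos \<phi>"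
  unfolding xivec_def
  using nvec_inner_tvec[of \<theta> \<phi>] tvec_inner_tvec[of \<theta> \<phi>]
  by (simp add: inner_diff_left inner_commute[of "tvec \<theta>"])

text \<open>
  In the orthonormal frame \<open>tvec \<theta>\<close>, \<open>nvec \<theta>\<close> all inner products are trigonometric functions of
  the turning angle \<open>\<phi>\<close>. The last factor has a component \<open>- tvec \<theta>\<close>, which is orthogonal to
  \<open>nvec \<theta>\<close>; therefore the linear term in \<open>r\<close> does not contain \<open>k\<close>.
\<close>

lemma Gmat_polar:
  "(Gmat \<gamma> \<alpha> k \<theta> *v (r *\<^sub>R tvec (\<theta> + \<phi>))) \<bullet> (r *\<^sub>R tvec (\<theta> + \<phi>) - tvec \<theta>)
    = (\<gamma> \<theta> + (\<alpha> - 1) * sin \<phi> * (\<gamma> \<theta> * sin \<phi> - deriv \<gamma> \<theta> * cos \<phi>) + k \<theta> * (sin \<phi>)\<^sup>2) * r\<^sup>2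
      - (\<gamma> \<theta> * cos \<phi> - \<alpha> * deriv \<gamma> \<theta> * sin \<phi>) * r"
proof -
  have unit: "tvec (\<theta> + \<phi>) \<bullet> tvec (\<theta> + \<phi>) = 1" and orth: "nvec \<theta> \<bullet> tvec \<theta> = 0"
    and xi: "xivec \<gamma> \<theta> \<bullet> tvec \<theta> = - deriv \<gamma> \<theta>"
    using tvec_inner_tvec[of "\<theta> + \<phi>" 0] nvec_inner_tvec[of \<theta> 0] xivec_inner_tvec[of \<gamma> \<theta> 0]
    by simp_all
  show ?thesis
    unfolding Gmat_bilinear inner_diff_right inner_scaleR_left inner_scaleR_right
      unit orth xi tvec_inner_tvec nvec_inner_tvec xivec_inner_tvec
    by (simp add: power2_eq_square algebra_simps)
qed

text \<open>
  The discriminant bound and \<open>c > 0\<close> force \<open>a \<ge> 0\<close>; in the boundary case \<open>a = 0\<close> they also force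
  \<open>b = 0\<close>.
\<close>

lemma quadratic_nonneg:
  fixes a b c r :: real
  assumes "c > 0" "b\<^sup>2 \<le> 4 * c * a"
  shows "0 \<le> a * r\<^sup>2 - b * r + c"
proof -
  have "b\<^sup>2 * r\<^sup>2 \<le> 4 * c * a * r\<^sup>2"
    using assms(2) by (rule mult_right_mono) simp
  (* Completing the square with respect to the constant term covers a = 0 as well. *)
  then have "(b * r - 2 * c)\<^sup>2 \<le> 4 * c * (a * r\<^sup>2 - b * r + c)"
    by (simp add: power2_eq_square algebra_simps)
  then have "0 \<le> 4 * c * (a * r\<^sup>2 - b * r + c)"
    using zero_le_power2 order_trans by blast
  then show ?thesis
    using assms(1) by (simp add: zero_le_mult_iff)
qed

lemma tvec_angle_of:
  assumes "v \<noteq> 0"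
  shows "tvec (angle_of v) = v /\<^sub>R norm v"
proof -
  have "norm (v /\<^sub>R norm v) = 1"
    using assms by simp
  then have "((v /\<^sub>R norm v) $ 1)\<^sup>2 + ((v /\<^sub>R norm v) $ 2)\<^sup>2 = 1"
    unfolding norm_vec_def L2_set_def by (simp add: sum_2)
  then obtain t where "(v /\<^sub>R norm v) $ 1 = cos t" "(v /\<^sub>R norm v) $ 2 = sin t"
    using sincos_total_2pi by metis
  then have "tvec t = v /\<^sub>R norm v"
    unfolding tvec_def by (simp add: vec_eq_iff forall_2)
  then show ?thesis
    unfolding angle_of_def by (rule someI)
qed

text \<open>
  Dividing by \<open>norm p\<close> leaves the quadratic polynomial of \<open>stabilizes\<close> in \<open>r = norm q / norm p\<close>.
  The representatives chosen by \<open>angle_of\<close> may differ from the geometric turning angle by a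
  multiple of \<open>2 * pi\<close>, which is harmless because \<open>stabilizes\<close> quantifies over all real \<open>\<phi>\<close>.
\<close>

lemma edge_energy_bound:
  assumes p: "p \<noteq> 0" and q: "q \<noteq> 0" and pos: "\<gamma> (angle_of p) > 0"
    and stab: "stabilizes \<gamma> \<alpha> (angle_of p) (k (angle_of p))"
  shows "\<gamma> (angle_of q) * norm q - \<gamma> (angle_of p) * norm p
    \<le> norm p * ((Gmat \<gamma> \<alpha> k (angle_of p) *v (q /\<^sub>R norm p)) \<bullet> ((q - p) /\<^sub>R norm p))"
proof -
  define \<theta> where "\<theta> = angle_of p"
  define \<phi> where "\<phi> = angle_of q - \<theta>"
  define r where "r = norm q / norm p"
  let ?a = "\<gamma> \<theta> + (\<alpha> - 1) * sin \<phi> * (\<gamma> \<theta> * sin \<phi> - deriv \<gamma> \<theta> * cos \<phi>) + k \<theta> * (sin \<phi>)\<^sup>2"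
  let ?b = "\<gamma> \<theta> * cos \<phi> - \<alpha> * deriv \<gamma> \<theta> * sin \<phi>"
  have p': "p /\<^sub>R norm p = tvec \<theta>"
    using tvec_angle_of[OF p] \<theta>_def by simp
  have q': "q /\<^sub>R norm p = r *\<^sub>R tvec (\<theta> + \<phi>)"
    using tvec_angle_of[OF q] p q unfolding \<phi>_def r_def by (simp add: field_simps)
  have quad: "(Gmat \<gamma> \<alpha> k \<theta> *v (q /\<^sub>R norm p)) \<bullet> ((q - p) /\<^sub>R norm p) = ?a * r\<^sup>2 - ?b * r"
    unfolding scaleR_diff_right p' q' by (rule Gmat_polar)
  have "(?b + \<gamma> (\<theta> + \<phi>))\<^sup>2 \<le> 4 * \<gamma> \<theta> * ?a"
    using stab unfolding stabilizes_def \<theta>_def by blast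
  then have "0 \<le> ?a * r\<^sup>2 - (?b + \<gamma> (\<theta> + \<phi>)) * r + \<gamma> \<theta>"
    using pos unfolding \<theta>_def by (intro quadratic_nonneg)
  then have "\<gamma> (\<theta> + \<phi>) * r - \<gamma> \<theta> \<le> ?a * r\<^sup>2 - ?b * r"
    by (simp add: algebra_simps)
  then have "norm p * (\<gamma> (\<theta> + \<phi>) * r - \<gamma> \<theta>) \<le> norm p * (?a * r\<^sup>2 - ?b * r)"
    by (rule mult_left_mono) simp
  moreover have "norm p * (\<gamma> (\<theta> + \<phi>) * r - \<gamma> \<theta>)
      = \<gamma> (angle_of q) * norm q - \<gamma> (angle_of p) * norm p"
    using p unfolding r_def \<phi>_def \<theta>_def by (simp add: field_simps)
  ultimately show ?thesis
    using quad unfolding \<theta>_def by simp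
qed

section \<open>Decay of energy in one step\<close>

text \<open>
  The test functions \<open>Y - X\<close> and \<open>\<mu>\<close> give \<open>?S = - dt * (\<mu>, \<mu>)\<close> for the edge sum \<open>?S\<close>, and
  \<open>edge_energy_bound\<close> compares \<open>?S\<close> with the energy increment edge by edge.
\<close>

lemma energy_decay_step:
  assumes N: "N > 0" and dt: "dt > 0" and X: "X \<in> Kph2 N"
    and edges: "\<And>j. 1 \<le> j \<Longrightarrow> j \<le> N \<Longrightarrow> edge N X j \<noteq> 0"
    and edges': "\<And>j. 1 \<le> j \<Longrightarrow> j \<le> N \<Longrightarrow> edge N Y j \<noteq> 0"
    and pos: "\<And>\<theta>. \<gamma> \<theta> > 0"
    and stab: "\<And>\<theta>. stabilizes \<gamma> \<alpha> \<theta> (k \<theta>)"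
    and step: "SP_PFEM_step \<gamma> \<alpha> k N dt X Y \<mu>"
  shows "energy \<gamma> N Y \<le> energy \<gamma> N X"
proof -
  let ?\<omega> = "\<lambda>\<rho>. Y \<rho> - X \<rho>"
  let ?S = "\<Sum>j=1..N. norm (edge N X j) *
        ((Gmat \<gamma> \<alpha> k (angle_of (edge N X j)) *v (edge N Y j /\<^sub>R norm (edge N X j)))
          \<bullet> (edge N ?\<omega> j /\<^sub>R norm (edge N X j)))"
  have Y: "Y \<in> Kph2 N" and \<mu>: "\<mu> \<in> Kph N"
    and eq1: "lumped N X (\<lambda>\<rho>. nhalf N X Y \<rho> \<bullet> ((Y \<rho> - X \<rho>) /\<^sub>R dt)) \<mu> + lumped N X \<mu> \<mu> = 0"
    using step unfolding SP_PFEM_step_def by auto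
  have \<omega>: "?\<omega> \<in> Kph2 N"
    using X Y by (intro Kph2_diff)
  have eq2: "lumped N X (\<lambda>\<rho>. \<mu> \<rho> *\<^sub>R nhalf N X Y \<rho>) ?\<omega> = ?S"
    using step \<omega> unfolding SP_PFEM_step_def lumped_stress_eq[OF N] by auto
  have "lumped N X (\<lambda>\<rho>. \<mu> \<rho> *\<^sub>R nhalf N X Y \<rho>) ?\<omega>
      = dt * lumped N X (\<lambda>\<rho>. nhalf N X Y \<rho> \<bullet> ((Y \<rho> - X \<rho>) /\<^sub>R dt)) \<mu>"
    unfolding lumped_force_eq[OF N \<omega> \<mu>] lumped_mobility_eq[OF N X Y \<mu>] sum_distrib_left
    using dt
    by (intro sum.cong refl)
       (simp only: inner_scaleR_left inner_scaleR_right, simp add: field_simps)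
  also have "\<dots> = - (dt * lumped N X \<mu> \<mu>)"
    using eq1 by (simp add: eq_neg_iff_add_eq_0 flip: distrib_left)
  also have "\<dots> \<le> 0"
  proof -
    have "0 \<le> lumped N X \<mu> \<mu>"
      unfolding lumped_Kph_eq[OF N \<mu> \<mu>] by (intro sum_nonneg mult_nonneg_nonneg) auto
    then show ?thesis using dt by simp
  qed
  finally have S: "?S \<le> 0"
    using eq2 by simp
  have "energy \<gamma> N Y - energy \<gamma> N X = (\<Sum>j=1..N.
      \<gamma> (angle_of (edge N Y j)) * norm (edge N Y j) - \<gamma> (angle_of (edge N X j)) * norm (edge N X j))"
    unfolding energy_def by (simp add: sum_subtractf)
  also have "\<dots> \<le> ?S"
  proof (rule sum_mono)
    fix j assume j: "j \<in> {1..N}"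
    have "edge N ?\<omega> j = edge N Y j - edge N X j"
      unfolding edge_def by simp
    then show "\<gamma> (angle_of (edge N Y j)) * norm (edge N Y j)
        - \<gamma> (angle_of (edge N X j)) * norm (edge N X j)
      \<le> norm (edge N X j) *
        ((Gmat \<gamma> \<alpha> k (angle_of (edge N X j)) *v (edge N Y j /\<^sub>R norm (edge N X j)))
          \<bullet> (edge N ?\<omega> j /\<^sub>R norm (edge N X j)))"
      using edge_energy_bound[of "edge N X j" "edge N Y j" \<gamma> \<alpha> k] edges edges' pos stab j by auto
  qed
  finally show ?thesis using S by simp
qed

section \<open>Existence of a stabilizing constant\<close>

text \<open>
  The positive derivative of \<open>g'\<close> at \<open>a\<close> makes \<open>g'\<close> change sign there from negative to positive,
  so that \<open>g\<close> falls before \<open>a\<close> and rises after it.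
\<close>

lemma second_derivative_local_min:
  fixes g :: "real \<Rightarrow> real"
  assumes g: "\<And>x. (g has_real_derivative g' x) (at x)"
    and crit: "g' a = 0" and g': "(g' has_real_derivative D) (at a)" and D: "D > 0"
  shows "eventually (\<lambda>x. g a \<le> g x) (nhds a)"
proof -
  obtain d1 where d1: "d1 > 0" "\<And>h. h > 0 \<Longrightarrow> h < d1 \<Longrightarrow> 0 < g' (a + h)"
    using DERIV_pos_inc_right[OF g' D] crit by auto
  obtain d2 where d2: "d2 > 0" "\<And>h. h > 0 \<Longrightarrow> h < d2 \<Longrightarrow> g' (a - h) < 0"
    using DERIV_pos_inc_left[OF g' D] crit by auto
  have "g a \<le> g x" if x: "dist x a < min d1 d2" for x
  proof (cases "a \<le> x")
    case True
    have "\<exists>y. (g has_real_derivative y) (at z) \<and> y \<ge> 0" if "a \<le> z" "z \<le> x" for z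
      using g[of z] d1(2)[of "z - a"] crit x that by (cases "z = a") (auto simp: dist_real_def)
    then show ?thesis
      using True DERIV_nonneg_imp_nondecreasing[of a x g] by blast
  next
    case False
    have "\<exists>y. (g has_real_derivative y) (at z) \<and> y \<le> 0" if "x \<le> z" "z \<le> a" for z
      using g[of z] d2(2)[of "a - z"] crit x that by (cases "z = a") (auto simp: dist_real_def)
    then show ?thesis
      using False DERIV_nonpos_imp_nonincreasing[of x a g] by force
  qed
  moreover have "min d1 d2 > 0"
    using d1 d2 by simp
  ultimately show ?thesis
    unfolding eventually_nhds_metric by blast
qed

text \<open>
  At a zero of \<open>sin\<close> the function \<open>sin\<^sup>2\<close> has a double zero with second derivative \<open>2\<close>, so that
  adding \<open>K * sin\<^sup>2\<close> raises the second derivative of \<open>E\<close> at \<open>a\<close> by \<open>2 * K\<close>.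
\<close>

lemma sin_sq_dominates_double_zero:
  fixes E :: "real \<Rightarrow> real"
  assumes E: "\<And>x. (E has_real_derivative E' x) (at x)"
    and E': "(E' has_real_derivative D) (at a)"
    and zero: "E a = 0" "E' a = 0" "sin a = 0"
  shows "\<exists>K. eventually (\<lambda>x. 0 \<le> E x + K * (sin x)\<^sup>2) (nhds a)"
proof -
  (* This K makes the second derivative of the sum at a equal to 1. *)
  define K where "K = (1 - D) / 2"
  have cos: "(cos a)\<^sup>2 = 1"
    using zero(3) sin_cos_squared_add[of a] by simp
  have "((\<lambda>x. E x + K * (sin x)\<^sup>2) has_real_derivative E' x + 2 * K * sin x * cos x) (at x)" for x
    by (auto intro!: derivative_eq_intros E)
  moreover have "((\<lambda>x. E' x + 2 * K * sin x * cos x) has_real_derivative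
      D + 2 * K * ((cos a)\<^sup>2 - (sin a)\<^sup>2)) (at a)"
    by (auto intro!: derivative_eq_intros E' simp: power2_eq_square algebra_simps)
  moreover have "D + 2 * K * ((cos a)\<^sup>2 - (sin a)\<^sup>2) = 1"
    unfolding cos zero(3) K_def by (simp add: field_simps)
  ultimately have "eventually (\<lambda>x. E a + K * (sin a)\<^sup>2 \<le> E x + K * (sin x)\<^sup>2) (nhds a)"
    using zero by (intro second_derivative_local_min[where D = 1 and g' = "\<lambda>x. E' x + 2 * K * sin x * cos x"])
      (simp_all only: mult_zero_right mult_zero_left add_0_right zero_less_one)
  then show ?thesis
    using zero by auto
qed

lemma sin_sq_dominates_simple:
  fixes E :: "real \<Rightarrow> real"
  assumes cont: "isCont E a" and "E a > 0 \<or> sin a \<noteq> 0"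
  shows "\<exists>K. eventually (\<lambda>x. 0 \<le> E x + K * (sin x)\<^sup>2) (nhds a)"
proof -
  obtain K where K: "0 < E a + K * (sin a)\<^sup>2"
  proof (cases "E a > 0")
    case True
    then show ?thesis using that[of 0] by simp
  next
    case False
    then have "sin a \<noteq> 0" using assms by simp
    then have "E a + ((1 - E a) / (sin a)\<^sup>2) * (sin a)\<^sup>2 = 1" by simp
    then show ?thesis
      by - (rule that[of "(1 - E a) / (sin a)\<^sup>2"], linarith)
  qed
  have "isCont (\<lambda>x. E x + K * (sin x)\<^sup>2) a"
    using cont by (intro continuous_intros)
  then have "((\<lambda>x. E x + K * (sin x)\<^sup>2) \<longlongrightarrow> E a + K * (sin a)\<^sup>2) (nhds a)"
    by (simp only: isCont_def tendsto_at_iff_tendsto_nhds[of "\<lambda>x. E x + K * (sin x)\<^sup>2"])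
  then have "eventually (\<lambda>x. 0 < E x + K * (sin x)\<^sup>2) (nhds a)"
    using K by (rule order_tendstoD)
  then show ?thesis
    by (intro exI[of _ K]) (auto elim: eventually_mono)
qed

text \<open>
  Since \<open>w \<ge> 0\<close>, a larger multiplier is always as good; hence the finitely many multipliers
  of a subcover can be replaced by the sum of their absolute values.
\<close>

lemma compact_uniform_multiplier:
  fixes E w :: "'a::topological_space \<Rightarrow> real"
  assumes S: "compact S" and w: "\<And>x. 0 \<le> w x"
    and local: "\<And>a. a \<in> S \<Longrightarrow> \<exists>K. eventually (\<lambda>x. 0 \<le> E x + K * w x) (nhds a)"
  shows "\<exists>K. \<forall>x\<in>S. 0 \<le> E x + K * w x"
proof -
  have "\<forall>a\<in>S. \<exists>K U. open U \<and> a \<in> U \<and> (\<forall>x\<in>U. 0 \<le> E x + K * w x)"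
    using local unfolding eventually_nhds by blast
  then obtain K U where U: "\<And>a. a \<in> S \<Longrightarrow> open (U a) \<and> a \<in> U a \<and> (\<forall>x\<in>U a. 0 \<le> E x + K a * w x)"
    by metis
  obtain C where C: "C \<subseteq> S" "finite C" "S \<subseteq> (\<Union>a\<in>C. U a)"
    by (rule compactE_image[OF S, of S U]) (use U in auto)
  have "0 \<le> E x + (\<Sum>a\<in>C. \<bar>K a\<bar>) * w x" if x: "x \<in> S" for x
  proof -
    obtain a where a: "a \<in> C" "x \<in> U a"
      using C(3) x by blast
    have "K a \<le> (\<Sum>a\<in>C. \<bar>K a\<bar>)"
      using member_le_sum[OF a(1), of "\<lambda>a. \<bar>K a\<bar>"] C(2) by simp
    then have "E x + K a * w x \<le> E x + (\<Sum>a\<in>C. \<bar>K a\<bar>) * w x"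
      using w by (intro add_left_mono mult_right_mono)
    moreover have "0 \<le> E x + K a * w x"
      using U a C(1) by blast
    ultimately show ?thesis by linarith
  qed
  then show ?thesis by blast
qed

lemma periodic_reduce:
  fixes x :: real
  obtains y where "y \<in> {0..2 * pi}" "\<And>f::real \<Rightarrow> 'a. periodic_fun_simple f (2 * pi) \<Longrightarrow> f x = f y"
proof -
  define y where "y = x - of_int \<lfloor>x / (2 * pi)\<rfloor> * (2 * pi)"
  have "of_int \<lfloor>x / (2 * pi)\<rfloor> \<le> x / (2 * pi)" "x / (2 * pi) \<le> of_int \<lfloor>x / (2 * pi)\<rfloor> + 1"
    by linarith+
  then have "of_int \<lfloor>x / (2 * pi)\<rfloor> * (2 * pi) \<le> x" "x \<le> (of_int \<lfloor>x / (2 * pi)\<rfloor> + 1) * (2 * pi)"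
    by (simp_all only: pos_le_divide_eq pos_divide_le_eq pi_gt_zero zero_less_mult_iff zero_less_numeral simp_thms)
  then have "y \<in> {0..2 * pi}"
    unfolding y_def by (simp add: algebra_simps)
  moreover have "f x = f y" if "periodic_fun_simple f (2 * pi)" for f :: "real \<Rightarrow> 'a"
  proof -
    interpret periodic_fun_simple f "2 * pi" by fact
    show ?thesis
      unfolding y_def by (simp only: minus_of_int)
  qed
  ultimately show ?thesis using that by blast
qed

lemma deriv_periodic:
  assumes "periodic_fun_simple f p"
  shows "periodic_fun_simple (deriv f) (p::real)"
proof
  fix x
  interpret periodic_fun_simple f p by fact
  have "(f has_field_derivative D) (at (x + p)) \<longleftrightarrow> (f has_field_derivative D) (at x)" for D
    unfolding DERIV_shift by (simp add: plus_period)
  then show "deriv f (x + p) = deriv f x"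
    unfolding deriv_def by simp
qed

text \<open>
  \<open>E \<phi>\<close> below is the difference of the two sides of \<open>stabilizes\<close> for \<open>K = 0\<close>. At the zeros of
  \<open>sin\<close> either \<open>E > 0\<close> or \<open>E\<close> has a double zero. At \<open>pi\<close> the vanishing of the derivative comes
  from the first-order condition at a minimum of \<open>3 * \<gamma> x - \<gamma> (x + pi)\<close>.
\<close>

lemma exists_stabilizing:
  assumes per: "periodic_fun_simple \<gamma> (2 * pi)" and pos: "\<And>\<theta>. \<gamma> \<theta> > 0"
    and \<gamma>1: "\<And>x. \<gamma> differentiable (at x)" and \<gamma>2: "\<And>x. deriv \<gamma> differentiable (at x)"
    and cond: "\<And>x. 3 * \<gamma> x - \<gamma> (x - pi) \<ge> 0"
    and strict: "\<alpha> = -1 \<or> 3 * \<gamma> \<theta> - \<gamma> (\<theta> - pi) > 0"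
  shows "\<exists>K. stabilizes \<gamma> \<alpha> \<theta> K"
proof -
  interpret periodic_fun_simple \<gamma> "2 * pi" by fact
  interpret d: periodic_fun_simple "deriv \<gamma>" "2 * pi"
    by (rule deriv_periodic) fact
  define d where "d = deriv \<gamma> \<theta>"
  define C where "C = (\<lambda>\<phi>. \<gamma> \<theta> * cos \<phi> - \<alpha> * d * sin \<phi> + \<gamma> (\<theta> + \<phi>))"
  define C' where "C' = (\<lambda>\<phi>. - \<gamma> \<theta> * sin \<phi> - \<alpha> * d * cos \<phi> + deriv \<gamma> (\<theta> + \<phi>))"
  define E where "E = (\<lambda>\<phi>. 4 * \<gamma> \<theta> * (\<gamma> \<theta> + (\<alpha> - 1) * sin \<phi> * (\<gamma> \<theta> * sin \<phi> - d * cos \<phi>)) - (C \<phi>)\<^sup>2)"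
  define E' where "E' = (\<lambda>\<phi>. 4 * \<gamma> \<theta> * (\<alpha> - 1) *
      (2 * \<gamma> \<theta> * sin \<phi> * cos \<phi> - d * (cos \<phi> * cos \<phi> - sin \<phi> * sin \<phi>))
      - 2 * C \<phi> * C' \<phi>)"
  have D1: "(\<gamma> has_real_derivative deriv \<gamma> x) (at x)" for x
    using \<gamma>1 DERIV_deriv_iff_real_differentiable by blast
  have D2: "(deriv \<gamma> has_real_derivative deriv (deriv \<gamma>) x) (at x)" for x
    using \<gamma>2 DERIV_deriv_iff_real_differentiable by blast
  have S1: "((\<lambda>\<phi>. \<gamma> (\<theta> + \<phi>)) has_real_derivative deriv \<gamma> (\<theta> + x)) (at x)" for x
    using D1[of "x + \<theta>"] unfolding DERIV_shift by (simp add: add.commute)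
  have S2: "((\<lambda>\<phi>. deriv \<gamma> (\<theta> + \<phi>)) has_real_derivative deriv (deriv \<gamma>) (\<theta> + x)) (at x)" for x
    using D2[of "x + \<theta>"] unfolding DERIV_shift by (simp add: add.commute)
  have C: "(C has_real_derivative C' x) (at x)" for x
    unfolding C_def C'_def by (auto intro!: derivative_eq_intros S1)
  have E: "(E has_real_derivative E' x) (at x)" for x
    unfolding E_def E'_def
    by (auto intro!: derivative_eq_intros C simp: algebra_simps)
  have "\<exists>D. (C' has_real_derivative D) (at x)" for x
    unfolding C'_def by (rule exI) (rule derivative_eq_intros S2 refl)+
  then obtain C'' where C': "(C' has_real_derivative C'' x) (at x)" for x
    by metis
  have E': "\<exists>D. (E' has_real_derivative D) (at x)" for x
    unfolding E'_def by (rule exI) (rule derivative_eq_intros C C' refl)+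
  have opposite: "\<gamma> (\<theta> + pi) = \<gamma> (\<theta> - pi)"
    using plus_period[of "\<theta> - pi"] by (simp add: algebra_simps)
  have zero_double: "E 0 = 0 \<and> E' 0 = 0"
    unfolding E_def E'_def C_def C'_def d_def by (simp add: power2_eq_square algebra_simps)
  have E_pi: "E pi = (3 * \<gamma> \<theta> - \<gamma> (\<theta> - pi)) * (\<gamma> \<theta> + \<gamma> (\<theta> - pi))"
    unfolding E_def C_def opposite by (simp add: opposite power2_eq_square algebra_simps)
  have pi_double: "E pi = 0 \<and> E' pi = 0" if not_pos: "\<not> E pi > 0"
  proof -
    have "\<gamma> \<theta> + \<gamma> (\<theta> - pi) > 0"
      using pos by (simp add: add_pos_pos)
    then have crit: "3 * \<gamma> \<theta> - \<gamma> (\<theta> - pi) = 0"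
      using not_pos cond[of \<theta>] unfolding E_pi by (simp add: zero_less_mult_iff)
    then have \<alpha>: "\<alpha> = -1" using strict by simp
    (* In the case of equality theta is a global minimiser of the defect in the hypothesis. *)
    have "((\<lambda>x. 3 * \<gamma> x - \<gamma> (x + pi)) has_real_derivative 3 * d - deriv \<gamma> (\<theta> + pi)) (at \<theta>)"
      unfolding d_def using D1[of "\<theta> + pi"] unfolding DERIV_shift
      by (intro derivative_intros DERIV_cmult D1)
    moreover have "3 * \<gamma> \<theta> - \<gamma> (\<theta> + pi) \<le> 3 * \<gamma> x - \<gamma> (x + pi)" for x
      using cond[of x] crit opposite plus_period[of "x - pi"] by (simp add: algebra_simps)
    ultimately have "3 * d - deriv \<gamma> (\<theta> + pi) = 0"
      by (intro DERIV_local_min[where d = 1]) auto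
    then have der: "deriv \<gamma> (\<theta> + pi) = 3 * d" by simp
    have "\<gamma> (\<theta> + pi) = 3 * \<gamma> \<theta>"
      using crit opposite by simp
    then have "C pi = 2 * \<gamma> \<theta>" "C' pi = 2 * d"
      unfolding C_def C'_def by (simp_all add: der \<alpha>)
    then show ?thesis
      unfolding E_pi crit E'_def by (simp add: \<alpha>)
  qed
  have loc: "\<exists>K. eventually (\<lambda>x. 0 \<le> E x + K * (sin x)\<^sup>2) (nhds a)" if a: "a \<in> {0..2 * pi}" for a
  proof (cases "E a > 0 \<or> sin a \<noteq> 0")
    case True
    then show ?thesis
      by (intro sin_sq_dominates_simple DERIV_isCont[OF E])
  next
    case False
    have E_2pi: "E (2 * pi) = E 0 \<and> E' (2 * pi) = E' 0"
      unfolding E_def E'_def C_def C'_def by (simp add: plus_period d.plus_period)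
    have "a = 0 \<or> a = pi \<or> a = 2 * pi"
      using False a sin_gt_zero[of a] sin_lt_zero[of a] by (cases a pi rule: linorder_cases) force+
    then have "E a = 0 \<and> E' a = 0"
      using zero_double pi_double E_2pi False by auto
    then show ?thesis
      using E' False sin_sq_dominates_double_zero[OF E] by blast
  qed
  obtain K where K: "\<forall>x\<in>{0..2 * pi}. 0 \<le> E x + K * (sin x)\<^sup>2"
    using compact_uniform_multiplier[OF compact_Icc zero_le_power2 loc] by blast
  have "0 \<le> E x + K * (sin x)\<^sup>2" for x
  proof -
    obtain y where y: "y \<in> {0..2 * pi}"
      "\<And>f::real \<Rightarrow> real. periodic_fun_simple f (2 * pi) \<Longrightarrow> f x = f y"
      using periodic_reduce by blast
    have "periodic_fun_simple (\<lambda>x. E x + K * (sin x)\<^sup>2) (2 * pi)"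
      unfolding E_def C_def periodic_fun_simple_def
      by (simp add: plus_period flip: add.assoc)
    from y(2)[OF this] show ?thesis
      using K y(1) by simp
  qed
  moreover have "4 * \<gamma> \<theta> * (b + K / (4 * \<gamma> \<theta>) * s) = 4 * \<gamma> \<theta> * b + K * s" for b s
    using pos[of \<theta>] by (simp add: field_simps)
  ultimately have "stabilizes \<gamma> \<alpha> \<theta> (K / (4 * \<gamma> \<theta>))"
    unfolding stabilizes_def E_def C_def d_def using pos[of \<theta>] by (auto simp: algebra_simps)
  then show ?thesis by blast
qed

lemma stabilizes_periodic:
  assumes "periodic_fun_simple \<gamma> (2 * pi)"
  shows "stabilizes \<gamma> \<alpha> (\<theta> + 2 * pi) = stabilizes \<gamma> \<alpha> \<theta>"
proof -
  interpret periodic_fun_simple \<gamma> "2 * pi" by fact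
  interpret d: periodic_fun_simple "deriv \<gamma>" "2 * pi"
    by (rule deriv_periodic) fact
  have "\<gamma> (\<theta> + 2 * pi + \<phi>) = \<gamma> (\<theta> + \<phi>)" for \<phi>
    using plus_period[of "\<theta> + \<phi>"] by (simp add: algebra_simps)
  then show ?thesis
    unfolding stabilizes_def by (intro ext) (simp add: plus_period d.plus_period)
qed

section \<open>From one step to the whole scheme\<close>

lemma solution_edges:
  assumes "SP_PFEM_solution \<gamma> \<alpha> k N T M X \<mu>" "m \<le> M" "1 \<le> j" "j \<le> N"
  shows "edge N (X m) j \<noteq> 0"
proof -
  let ?A = "(\<lambda>j. norm (edge N (X m) j)) ` {1..N}"
  have "Min ?A > 0"
    using assms unfolding SP_PFEM_solution_def by blast
  moreover have "Min ?A \<le> norm (edge N (X m) j)"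
    using assms by (intro Min_le) auto
  ultimately show ?thesis by auto
qed

lemma solution_Kph2:
  assumes "SP_PFEM_solution \<gamma> \<alpha> k N T M X \<mu>" "m \<le> M"
  shows "X m \<in> Kph2 N"
  using assms unfolding SP_PFEM_solution_def SP_PFEM_step_def by (cases m) auto

text \<open>
  The threshold is chosen independently for each angle. The choice depends on \<open>\<theta>\<close> only through
  the predicate \<open>stabilizes \<gamma> \<alpha> \<theta>\<close>, which is the same for \<open>\<theta>\<close> and \<open>\<theta> + 2 * pi\<close>; so the
  threshold is periodic.
\<close>

lemma stable_if_stabilizes:
  assumes per: "periodic_fun_simple \<gamma> (2 * pi)" and pos: "\<And>\<theta>. \<gamma> \<theta> > 0"
    and ex: "\<And>\<theta>. \<exists>K. stabilizes \<gamma> \<alpha> \<theta> K"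
  shows "stable_for_large_k \<gamma> \<alpha>"
  unfolding stable_for_large_k_def
proof (intro exI conjI allI impI)
  let ?k = "\<lambda>\<theta>. SOME K. stabilizes \<gamma> \<alpha> \<theta> K"
  show "periodic_fun_simple ?k (2 * pi)"
    by standard (simp add: stabilizes_periodic[OF per])
  fix k assume k: "\<forall>\<theta>. ?k \<theta> \<le> k \<theta>"
  have stab: "stabilizes \<gamma> \<alpha> \<theta> (k \<theta>)" for \<theta>
    using stabilizes_mono[OF someI_ex[OF ex]] k pos by blast
  show "energy_stable \<gamma> \<alpha> k"
    unfolding energy_stable_def
  proof (intro allI impI)
    fix N T M X \<mu> and m l :: nat
    assume sol: "SP_PFEM_solution \<gamma> \<alpha> k N T M X \<mu>" and "m < M" "l \<le> m"
    then have "l \<le> M" "l + 1 \<le> M" by auto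
    moreover have "N > 0" "T / real M > 0"
      "SP_PFEM_step \<gamma> \<alpha> k N (T / real M) (X l) (X (l + 1)) (\<mu> (l + 1))"
      using sol \<open>l + 1 \<le> M\<close> unfolding SP_PFEM_solution_def by auto
    ultimately show "energy \<gamma> N (X (l + 1)) \<le> energy \<gamma> N (X l)"
      using energy_decay_step[where X = "X l" and Y = "X (l + 1)"]
        solution_edges[OF sol] solution_Kph2[OF sol] pos stab
      by blast
  qed
qed

theorem theorem3p4:
  fixes \<alpha> :: real and \<gamma> :: "real \<Rightarrow> real"
  assumes per: "periodic_fun_simple \<gamma> (2 * pi)"
    and pos: "\<And>\<theta>. \<gamma> \<theta> > 0"
  shows "((\<forall>\<theta>. \<gamma> differentiable (at \<theta>)) \<longrightarrow>
           (\<forall>k N T M X \<mu>. periodic_fun_simple k (2 * pi) \<longrightarrow> SP_PFEM_solution \<gamma> \<alpha> k N T M X \<mu> \<longrightarrow>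
              (\<forall>m<M. (area N (X (m + 1)) - area N (X m)) / (T / real M)
                      = - lumped N (X m) (\<mu> (m + 1)) (\<lambda>_. 1)))) \<and>
         (\<alpha> = -1 \<longrightarrow> C2_fun \<gamma> \<longrightarrow> (\<forall>\<theta>. 3 * \<gamma> \<theta> - \<gamma> (\<theta> - pi) \<ge> 0) \<longrightarrow>
           stable_for_large_k \<gamma> \<alpha>) \<and>
         (\<alpha> \<noteq> -1 \<longrightarrow> C2_fun \<gamma> \<longrightarrow> (\<forall>\<theta>. 3 * \<gamma> \<theta> - \<gamma> (\<theta> - pi) > 0) \<longrightarrow>
           stable_for_large_k \<gamma> \<alpha>)"
proof (intro conjI impI allI)
  fix k N T M X \<mu> m
  assume sol: "SP_PFEM_solution \<gamma> \<alpha> k N T M X \<mu>" and m: "m < M"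
  have "N > 0" "T / real M \<noteq> 0"
    "SP_PFEM_step \<gamma> \<alpha> k N (T / real M) (X m) (X (m + 1)) (\<mu> (m + 1))"
    using sol m unfolding SP_PFEM_solution_def by auto
  then show "(area N (X (m + 1)) - area N (X m)) / (T / real M)
      = - lumped N (X m) (\<mu> (m + 1)) (\<lambda>_. 1)"
    using area_decay_step[where X = "X m" and Y = "X (m + 1)"]
      solution_edges[OF sol] solution_Kph2[OF sol] m
    by (meson less_imp_le_nat)
next
  assume "\<alpha> = -1" "C2_fun \<gamma>" "\<forall>\<theta>. 3 * \<gamma> \<theta> - \<gamma> (\<theta> - pi) \<ge> 0"
  then have "\<exists>K. stabilizes \<gamma> \<alpha> \<theta> K" for \<theta>
    using per pos unfolding C2_fun_def by (intro exists_stabilizing) auto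
  then show "stable_for_large_k \<gamma> \<alpha>"
    using per pos by (intro stable_if_stabilizes)
next
  assume "\<alpha> \<noteq> -1" "C2_fun \<gamma>" "\<forall>\<theta>. 3 * \<gamma> \<theta> - \<gamma> (\<theta> - pi) > 0"
  then have "\<exists>K. stabilizes \<gamma> \<alpha> \<theta> K" for \<theta>
    using per pos unfolding C2_fun_def by (intro exists_stabilizing) (auto intro: less_imp_le)
  then show "stable_for_large_k \<gamma> \<alpha>"
    using per pos by (intro stable_if_stabilizes)
qed

end
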